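(* Let $K$ be a field with $\operatorname{char} K\neq 2$, let $a,b,c\in K$, and let $\mathbb{O}(a,b,c)$ be the generalized octonion algebra over $K$. Let $\varepsilon\in\{\Phi,\Psi\}$, where $\Phi,\Psi:\mathbb{O}(a,b,c)\to\mathcal{M}_8(K)$ are the left and right matrix representations. Then for every $x\in\mathbb{O}(a,b,c)$ and every positive integer $n$, $$\varepsilon(x^{n})=\varepsilon(x)^{n}.$$
   Context: $\mathbb{O}(a,b,c)$ is the 8-dimensional $K$-algebra with basis $\{1,f_1,\dots,f_7\}$, unit $1$, and products $f_if_j$ given by the following rows (row $f_i$ lists $f_if_1,f_if_2,\dots,f_if_7$): $f_1$: $a,\ f_3,\ af_2,\ f_5,\ af_4,\ -f_7,\ -af_6$; $f_2$: $-f_3,\ b,\ -bf_1,\ f_6,\ f_7,\ bf_4,\ bf_5$; $f_3$: $-af_2,\ bf_1,\ -ab,\ f_7,\ af_6,\ -bf_5,\ -abf_4$; $f_4$: $-f_5,\ -f_6,\ -f_7,\ c,\ -cf_1,\ -cf_2,\ -cf_3$; $f_5$: $-af_4,\ -f_7,\ -af_6,\ cf_1,\ -ac,\ cf_3,\ acf_2$; $f_6$: $f_7,\ -bf_4,\ bf_5,\ cf_2,\ -cf_3,\ -bc,\ -bcf_1$; $f_7$: $af_6,\ -bf_5,\ abf_4,\ cf_3,\ -acf_2,\ bcf_1,\ abc$. This algebra is non-associative but alternative and power-associative, so the powers $x^n$ are well defined. For $x=x_0+x_1f_1+\dots+x_7f_7$ the left representation is $$\Phi(x)=\begin{pmatrix}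 x_0&ax_1&bx_2&-abx_3&cx_4&-acx_5&-bcx_6&abcx_7\\ x_1&x_0&bx_3&-bx_2&cx_5&-cx_4&bcx_7&-bcx_6\\ x_2&-ax_3&x_0&ax_1&cx_6&-acx_7&-cx_4&acx_5\\ x_3&-x_2&x_1&x_0&cx_7&-cx_6&cx_5&-cx_4\\ x_4&-ax_5&-bx_6&abx_7&x_0&ax_1&bx_2&-abx_3\\ x_5&-x_4&-bx_7&bx_6&x_1&x_0&-bx_3&bx_2\\ x_6&ax_7&-x_4&-ax_5&x_2&ax_3&x_0&-ax_1\\ x_7&x_6&-x_5&-x_4&x_3&x_2&-x_1&x_0 \end{pmatrix}$$ and the right representation is $$\Psi(x)=\begin{pmatrix} x_0&ax_1&bx_2&-abx_3&cx_4&-acx_5&-bcx_6&abcx_7\\ x_1&x_0&-bx_3&bx_2&-cx_5&cx_4&-bcx_7&bcx_6\\ x_2&ax_3&x_0&-ax_1&-cx_6&acx_7&cx_4&-acx_5\\ x_3&x_2&-x_1&x_0&-cx_7&cx_6&-cx_5&cx_4\\ x_4&ax_5&bx_6&-abx_7&x_0&-ax_1&-bx_2&abx_3\\ x_5&x_4&bx_7&-bx_6&-x_1&x_0&bx_3&-bx_2\\ x_6&-ax_7&x_4&ax_5&-x_2&-ax_3&x_0&ax_1\\ x_7&-x_6&x_5&x_4&-x_3&-x_2&x_1&x_0 \end{pmatrix}.$$ *)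

theory Defs
  imports "Jordan_Normal_Form.Matrix"
begin

text \<open>
  The algebra \<open>\<O>(a,b,c)\<close> lives on \<^term>\<open>carrier_vec 8\<close>: the coordinate vector of
  \<open>x\<^sub>0 + x\<^sub>1 f\<^sub>1 + \<dots> + x\<^sub>7 f\<^sub>7\<close>. The basis vector with index \<open>0\<close> is the unit.
\<close>

definition oct_basis :: "nat \<Rightarrow> 'a :: field vec" where
  "oct_basis i = unit_vec 8 i"

text \<open>Entry \<open>(i, j)\<close> is the product of the basis vectors \<open>i\<close> and \<open>j\<close>.\<close>

definition oct_table :: "'a :: field \<Rightarrow> 'a \<Rightarrow> 'a \<Rightarrow> 'a vec list list" where
  "oct_table a b c = (let e = oct_basis 0; f = oct_basis in
    [[e,   f 1,          f 2,          f 3,              f 4,      f 5,                f 6,              f 7],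
     [f 1, a \<cdot>\<^sub>v e,       f 3,          a \<cdot>\<^sub>v f 2,         f 5,      a \<cdot>\<^sub>v f 4,           - f 7,            (- a) \<cdot>\<^sub>v f 6],
     [f 2, - f 3,        b \<cdot>\<^sub>v e,       (- b) \<cdot>\<^sub>v f 1,     f 6,      f 7,                b \<cdot>\<^sub>v f 4,         b \<cdot>\<^sub>v f 5],
     [f 3, (- a) \<cdot>\<^sub>v f 2, b \<cdot>\<^sub>v f 1,     (- (a * b)) \<cdot>\<^sub>v e, f 7,      a \<cdot>\<^sub>v f 6,           (- b) \<cdot>\<^sub>v f 5,     (- (a * b)) \<cdot>\<^sub>v f 4],
     [f 4, - f 5,        - f 6,        - f 7,            c \<cdot>\<^sub>v e,   (- c) \<cdot>\<^sub>v f 1,       (- c) \<cdot>\<^sub>v f 2,     (- c) \<cdot>\<^sub>v f 3],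
     [f 5, (- a) \<cdot>\<^sub>v f 4, - f 7,        (- a) \<cdot>\<^sub>v f 6,     c \<cdot>\<^sub>v f 1, (- (a * c)) \<cdot>\<^sub>v e,   c \<cdot>\<^sub>v f 3,         (a * c) \<cdot>\<^sub>v f 2],
     [f 6, f 7,          (- b) \<cdot>\<^sub>v f 4, b \<cdot>\<^sub>v f 5,         c \<cdot>\<^sub>v f 2, (- c) \<cdot>\<^sub>v f 3,       (- (b * c)) \<cdot>\<^sub>v e, (- (b * c)) \<cdot>\<^sub>v f 1],
     [f 7, a \<cdot>\<^sub>v f 6,     (- b) \<cdot>\<^sub>v f 5, (a * b) \<cdot>\<^sub>v f 4,   c \<cdot>\<^sub>v f 3, (- (a * c)) \<cdot>\<^sub>v f 2, (b * c) \<cdot>\<^sub>v f 1,   (a * b * c) \<cdot>\<^sub>v e]])"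

text \<open>The bilinear extension of the table.\<close>

definition oct_mult :: "'a :: field \<Rightarrow> 'a \<Rightarrow> 'a \<Rightarrow> 'a vec \<Rightarrow> 'a vec \<Rightarrow> 'a vec" where
  "oct_mult a b c x y =
     vec 8 (\<lambda>k. \<Sum>i<8. \<Sum>j<8. x $ i * y $ j * (oct_table a b c ! i ! j) $ k)"

text \<open>
  The algebra is not associative, but it is power-associative, so the bracketing
  chosen here is immaterial.
\<close>

primrec oct_pow :: "'a :: field \<Rightarrow> 'a \<Rightarrow> 'a \<Rightarrow> 'a vec \<Rightarrow> nat \<Rightarrow> 'a vec" where
  "oct_pow a b c x 0 = oct_basis 0"
| "oct_pow a b c x (Suc n) = oct_mult a b c (oct_pow a b c x n) x"

definition oct_left_rep :: "'a :: field \<Rightarrow> 'a \<Rightarrow> 'a \<Rightarrow> 'a vec \<Rightarrow> 'a mat" where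
  "oct_left_rep a b c x = mat_of_rows_list 8
    [[x $ 0, a * x $ 1,   b * x $ 2,   - a * b * x $ 3, c * x $ 4, - a * c * x $ 5, - b * c * x $ 6, a * b * c * x $ 7],
     [x $ 1, x $ 0,       b * x $ 3,   - b * x $ 2,     c * x $ 5, - c * x $ 4,     b * c * x $ 7,   - b * c * x $ 6],
     [x $ 2, - a * x $ 3, x $ 0,       a * x $ 1,       c * x $ 6, - a * c * x $ 7, - c * x $ 4,     a * c * x $ 5],
     [x $ 3, - x $ 2,     x $ 1,       x $ 0,           c * x $ 7, - c * x $ 6,     c * x $ 5,       - c * x $ 4],
     [x $ 4, - a * x $ 5, - b * x $ 6, a * b * x $ 7,   x $ 0,     a * x $ 1,       b * x $ 2,       - a * b * x $ 3],
     [x $ 5, - x $ 4,     - b * x $ 7, b * x $ 6,       x $ 1,     x $ 0,           - b * x $ 3,     b * x $ 2],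
     [x $ 6, a * x $ 7,   - x $ 4,     - a * x $ 5,     x $ 2,     a * x $ 3,       x $ 0,           - a * x $ 1],
     [x $ 7, x $ 6,       - x $ 5,     - x $ 4,         x $ 3,     x $ 2,           - x $ 1,         x $ 0]]"

definition oct_right_rep :: "'a :: field \<Rightarrow> 'a \<Rightarrow> 'a \<Rightarrow> 'a vec \<Rightarrow> 'a mat" where
  "oct_right_rep a b c x = mat_of_rows_list 8
    [[x $ 0, a * x $ 1,   b * x $ 2,   - a * b * x $ 3, c * x $ 4,   - a * c * x $ 5, - b * c * x $ 6, a * b * c * x $ 7],
     [x $ 1, x $ 0,       - b * x $ 3, b * x $ 2,       - c * x $ 5, c * x $ 4,       - b * c * x $ 7, b * c * x $ 6],
     [x $ 2, a * x $ 3,   x $ 0,       - a * x $ 1,     - c * x $ 6, a * c * x $ 7,   c * x $ 4,       - a * c * x $ 5],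
     [x $ 3, x $ 2,       - x $ 1,     x $ 0,           - c * x $ 7, c * x $ 6,       - c * x $ 5,     c * x $ 4],
     [x $ 4, a * x $ 5,   b * x $ 6,   - a * b * x $ 7, x $ 0,       - a * x $ 1,     - b * x $ 2,     a * b * x $ 3],
     [x $ 5, x $ 4,       b * x $ 7,   - b * x $ 6,     - x $ 1,     x $ 0,           b * x $ 3,       - b * x $ 2],
     [x $ 6, - a * x $ 7, x $ 4,       a * x $ 5,       - x $ 2,     - a * x $ 3,     x $ 0,           a * x $ 1],
     [x $ 7, - x $ 6,     x $ 5,       x $ 4,           - x $ 3,     - x $ 2,         x $ 1,           x $ 0]]"

end

theory Submission
  imports Defs
begin

text \<open>
  Every \<open>x\<close> is a root of a quadratic \<open>x\<^sup>2 = 2 x\<^sub>0 x - N(x) 1\<close>, and so are the matrices \<open>\<Phi>(x)\<close> and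
  \<open>\<Psi>(x)\<close>. Hence all powers of \<open>x\<close> lie in the span of \<open>1\<close> and \<open>x\<close>, on which the linear map \<open>\<epsilon>\<close> is
  multiplicative.
\<close>

definition oct_norm :: "'a :: field \<Rightarrow> 'a \<Rightarrow> 'a \<Rightarrow> 'a vec \<Rightarrow> 'a" where
  "oct_norm a b c x = (x $ 0)\<^sup>2 - a * (x $ 1)\<^sup>2 - b * (x $ 2)\<^sup>2 + a * b * (x $ 3)\<^sup>2
     - c * (x $ 4)\<^sup>2 + a * c * (x $ 5)\<^sup>2 + b * c * (x $ 6)\<^sup>2 - a * b * c * (x $ 7)\<^sup>2"

lemma less_8_iff: "i < 8 \<longleftrightarrow> i \<in> {0, 1, 2, 3, 4, 5, 6, 7 :: nat}"
  by auto

lemma sum_less_8: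
  "(\<Sum>i<8. f i) = f 0 + f 1 + f 2 + f 3 + f 4 + f 5 + f 6 + f (7 :: nat)"
  for f :: "nat \<Rightarrow> 'a :: comm_monoid_add"
  by (simp add: eval_nat_numeral)

lemma vec_8_eqI:
  assumes "v \<in> carrier_vec 8" "w \<in> carrier_vec 8"
    and "v $ 0 = w $ 0" "v $ 1 = w $ 1" "v $ 2 = w $ 2" "v $ 3 = w $ 3"
    and "v $ 4 = w $ 4" "v $ 5 = w $ 5" "v $ 6 = w $ 6" "v $ 7 = w $ 7"
  shows "v = w"
  by (rule eq_vecI) (use assms in \<open>auto simp: less_8_iff\<close>)

text \<open>Membership in an explicit set replaces the bounds on \<open>i\<close> and
  \<open>j\<close>, so that \<open>elim insertE emptyE\<close> splits a matrix identity into 64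
  goals with literal indices.\<close>

lemma mat_8_eqI:
  assumes "dim_row A = 8" "dim_row B = 8" "dim_col A = 8" "dim_col B = 8"
    and "\<And>i j. \<lbrakk>i \<in> {0, 1, 2, 3, 4, 5, 6, 7}; j \<in> {0, 1, 2, 3, 4, 5, 6, 7}\<rbrakk> \<Longrightarrow> A $$ (i, j) = B $$ (i, j)"
  shows "A = B"
  by (rule eq_matI) (simp_all only: assms(1-4) less_8_iff assms(5))

lemma oct_basis_carrier [simp]: "oct_basis i \<in> carrier_vec 8"
  by (simp add: oct_basis_def)

lemma oct_mult_carrier [simp]: "oct_mult a b c x y \<in> carrier_vec 8"
  by (simp add: oct_mult_def)

text \<open>The left factor is the relevant one, since \<open>oct_pow\<close> appends each new
  \<open>x\<close> on the right.\<close>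

lemma oct_mult_linear_left:
  assumes "u \<in> carrier_vec 8" "v \<in> carrier_vec 8"
  shows "oct_mult a b c (p \<cdot>\<^sub>v u + q \<cdot>\<^sub>v v) y = p \<cdot>\<^sub>v oct_mult a b c u y + q \<cdot>\<^sub>v oct_mult a b c v y"
  using assms
  by (intro eq_vecI)
     (simp_all add: oct_mult_def sum_distrib_left flip: sum.distrib, simp add: algebra_simps)

lemma oct_mult_unit_left:
  assumes "x \<in> carrier_vec 8"
  shows "oct_mult a b c (oct_basis 0) x = x"
  by (rule vec_8_eqI)
     (use assms in \<open>simp_all add: oct_mult_def sum_less_8 oct_table_def Let_def oct_basis_def\<close>)

text \<open>Distinct non-unit basis vectors anticommute and each squares to a scalar. Hence the
  mixed terms of the square cancel, except those with the unit, which contribute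
  \<open>2 * x $ 0\<close>.\<close>

lemma oct_mult_self:
  assumes "x \<in> carrier_vec 8"
  shows "oct_mult a b c x x = (- oct_norm a b c x) \<cdot>\<^sub>v oct_basis 0 + (2 * x $ 0) \<cdot>\<^sub>v x"
  by (rule vec_8_eqI)
     (use assms in \<open>simp_all add: oct_mult_def sum_less_8 oct_table_def Let_def oct_basis_def oct_norm_def
        power2_eq_square algebra_simps\<close>)

lemma oct_left_rep_carrier [simp]: "oct_left_rep a b c x \<in> carrier_mat 8 8"
  by (rule carrier_matI) (simp_all add: oct_left_rep_def mat_of_rows_list_def)

lemma oct_right_rep_carrier [simp]: "oct_right_rep a b c x \<in> carrier_mat 8 8"
  by (rule carrier_matI) (simp_all add: oct_right_rep_def mat_of_rows_list_def)

lemma oct_left_rep_linear: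
  assumes "u \<in> carrier_vec 8" "v \<in> carrier_vec 8"
  shows "oct_left_rep a b c (p \<cdot>\<^sub>v u + q \<cdot>\<^sub>v v) = p \<cdot>\<^sub>m oct_left_rep a b c u + q \<cdot>\<^sub>m oct_left_rep a b c v"
  using assms
  by (intro mat_8_eqI; (elim insertE emptyE)?)
     (simp_all add: oct_left_rep_def mat_of_rows_list_def algebra_simps)

lemma oct_right_rep_linear:
  assumes "u \<in> carrier_vec 8" "v \<in> carrier_vec 8"
  shows "oct_right_rep a b c (p \<cdot>\<^sub>v u + q \<cdot>\<^sub>v v) = p \<cdot>\<^sub>m oct_right_rep a b c u + q \<cdot>\<^sub>m oct_right_rep a b c v"
  using assms
  by (intro mat_8_eqI; (elim insertE emptyE)?)
     (simp_all add: oct_right_rep_def mat_of_rows_list_def algebra_simps)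

lemma oct_left_rep_unit: "oct_left_rep a b c (oct_basis 0) = 1\<^sub>m 8"
  by (intro mat_8_eqI; (elim insertE emptyE)?)
     (simp_all add: oct_left_rep_def oct_basis_def mat_of_rows_list_def)

lemma oct_right_rep_unit: "oct_right_rep a b c (oct_basis 0) = 1\<^sub>m 8"
  by (intro mat_8_eqI; (elim insertE emptyE)?)
     (simp_all add: oct_right_rep_def oct_basis_def mat_of_rows_list_def)

text \<open>Column \<open>j\<close> holds the coordinates of \<open>x\<close> times the
  \<open>j\<close>-th basis vector, so the left alternative law x(xy) = (xx)y lies behind this
  identity; here it is verified entry by entry.\<close>

lemma oct_left_rep_self:
  "oct_left_rep a b c x * oct_left_rep a b c x
     = (- oct_norm a b c x) \<cdot>\<^sub>m 1\<^sub>m 8 + (2 * x $ 0) \<cdot>\<^sub>m oct_left_rep a b c x"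
  by (intro mat_8_eqI; (elim insertE emptyE)?)
     (simp_all add: oct_left_rep_def mat_of_rows_list_def scalar_prod_def atLeast0LessThan
        sum_less_8 oct_norm_def power2_eq_square algebra_simps)

text \<open>The mirror image: the matrix describes multiplication by \<open>x\<close> on the right,
  and the underlying law is (yx)x = y(xx).\<close>

lemma oct_right_rep_self:
  "oct_right_rep a b c x * oct_right_rep a b c x
     = (- oct_norm a b c x) \<cdot>\<^sub>m 1\<^sub>m 8 + (2 * x $ 0) \<cdot>\<^sub>m oct_right_rep a b c x"
  by (intro mat_8_eqI; (elim insertE emptyE)?)
     (simp_all add: oct_right_rep_def mat_of_rows_list_def scalar_prod_def atLeast0LessThan
        sum_less_8 oct_norm_def power2_eq_square algebra_simps)

lemma oct_pow_in_span:
  assumes "x \<in> carrier_vec 8"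
  shows "\<exists>p q. oct_pow a b c x n = p \<cdot>\<^sub>v oct_basis 0 + q \<cdot>\<^sub>v x"
proof (induction n)
  case 0
  show ?case
    by (rule exI[of _ 1], rule exI[of _ 0]) (use assms in \<open>auto simp: oct_basis_def\<close>)
next
  case (Suc n)
  then obtain p q where "oct_pow a b c x n = p \<cdot>\<^sub>v oct_basis 0 + q \<cdot>\<^sub>v x"
    by blast
  then have "oct_pow a b c x (Suc n)
      = p \<cdot>\<^sub>v x + q \<cdot>\<^sub>v ((- oct_norm a b c x) \<cdot>\<^sub>v oct_basis 0 + (2 * x $ 0) \<cdot>\<^sub>v x)"
    using assms by (simp add: oct_mult_linear_left oct_mult_unit_left oct_mult_self)
  \<comment> \<open>Reducing the square of \<open>x\<close> by its quadratic sends the coefficients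
    \<open>(p, q)\<close> of one power to those of the next.\<close>
  also have "\<dots> = (- q * oct_norm a b c x) \<cdot>\<^sub>v oct_basis 0 + (p + q * (2 * x $ 0)) \<cdot>\<^sub>v x"
    by (rule eq_vecI) (use assms in \<open>auto simp: oct_basis_def algebra_simps\<close>)
  finally show ?case
    by blast
qed

text \<open>This isolates what both representations share: linearity, the unit, and the same
  quadratic relation for the image of \<open>x\<close> as for \<open>x\<close> itself.\<close>

lemma linear_rep_oct_pow:
  fixes \<epsilon> :: "'a :: field vec \<Rightarrow> 'a mat"
  assumes x: "x \<in> carrier_vec 8"
    and carrier: "\<And>u. \<epsilon> u \<in> carrier_mat 8 8"
    and linear: "\<And>p q u v. u \<in> carrier_vec 8 \<Longrightarrow> v \<in> carrier_vec 8
      \<Longrightarrow> \<epsilon> (p \<cdot>\<^sub>v u + q \<cdot>\<^sub>v v) = p \<cdot>\<^sub>m \<epsilon> u + q \<cdot>\<^sub>m \<epsilon> v"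
    and unit: "\<epsilon> (oct_basis 0) = 1\<^sub>m 8"
    and square: "\<epsilon> x * \<epsilon> x = (- oct_norm a b c x) \<cdot>\<^sub>m 1\<^sub>m 8 + (2 * x $ 0) \<cdot>\<^sub>m \<epsilon> x"
  shows "\<epsilon> (oct_pow a b c x n) = \<epsilon> x ^\<^sub>m n"
proof (induction n)
  case 0
  show ?case
    using carrier[of x] by (simp add: unit)
next
  case (Suc n)
  obtain p q where pq: "oct_pow a b c x n = p \<cdot>\<^sub>v oct_basis 0 + q \<cdot>\<^sub>v x"
    using oct_pow_in_span[OF x] by blast
  \<comment> \<open>General products need not be respected, but on the span of the unit and
    \<open>x\<close> the square of \<open>x\<close> is the only product to check.\<close>
  have "\<epsilon> (oct_mult a b c x x) = \<epsilon> x * \<epsilon> x"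
    using x by (simp only: oct_mult_self linear oct_basis_carrier unit square)
  then have "\<epsilon> (oct_pow a b c x (Suc n)) = p \<cdot>\<^sub>m \<epsilon> x + q \<cdot>\<^sub>m (\<epsilon> x * \<epsilon> x)"
    using x by (simp add: pq oct_mult_linear_left oct_mult_unit_left linear)
  \<comment> \<open>Factoring out \<open>\<epsilon> x\<close> on the right matches the recursion of
    \<open>^\<^sub>m\<close>, which also multiplies on the right.\<close>
  also have "\<dots> = (p \<cdot>\<^sub>m 1\<^sub>m 8 + q \<cdot>\<^sub>m \<epsilon> x) * \<epsilon> x"
    using carrier[of x]
    by (simp add: add_mult_distrib_mat[of _ 8 8] mult_smult_assoc_mat[of _ 8 8])
  also have "\<dots> = \<epsilon> (oct_pow a b c x n) * \<epsilon> x"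
    using x by (simp add: pq linear unit)
  finally show ?case
    using Suc by simp
qed

theorem proposition3:
  fixes a b c :: "'k :: field"
    and \<epsilon> :: "'k vec \<Rightarrow> 'k mat"
    and x :: "'k vec"
    and n :: nat
  assumes "CHAR('k) \<noteq> 2"
    and "\<epsilon> \<in> {oct_left_rep a b c, oct_right_rep a b c}"
    and "x \<in> carrier_vec 8"
    and "n > 0"
  shows "\<epsilon> (oct_pow a b c x n) = \<epsilon> x ^\<^sub>m n"
proof -
  consider "\<epsilon> = oct_left_rep a b c" | "\<epsilon> = oct_right_rep a b c"
    using assms(2) by blast
  then show ?thesis
  proof cases
    case 1
    show ?thesis
      unfolding 1 using assms(3)
      by (rule linear_rep_oct_pow)
         (simp_all only: oct_left_rep_carrier oct_left_rep_linear oct_left_rep_unit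
            oct_left_rep_self)
  next
    case 2
    show ?thesis
      unfolding 2 using assms(3)
      by (rule linear_rep_oct_pow)
         (simp_all only: oct_right_rep_carrier oct_right_rep_linear oct_right_rep_unit
            oct_right_rep_self)
  qed
qed

end
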